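(* For every $q\ge 2$, Bob has a winning strategy in the canonical ESD labeling game on the complete bipartite graph $K_{2,q}$.
   Context: For a graph $G=(V,E)$ and $l\in\mathbb N$, a vertex labeling $\phi:V\to\{1,\dots,l\}$ is an edge-sum distinguishing (ESD) labeling if $\phi$ is injective and the edge-weights $w_\phi(uv)=\phi(u)+\phi(v)$ are pairwise distinct over all edges $uv\in E$. ESD labeling game on $G$ with label set $L=\{1,\dots,l\}$: Alice and Bob alternate moves, Alice starting. In each move the player chooses a not-yet-labeled vertex and assigns to it a label from $L$ not used before; the move is legal if the edge-weights of edges with both endpoints labeled remain pairwise distinct. The game ends when no legal move is possible or an ESD labeling of $G$ is created; Alice wins if an ESD labeling is created, otherwise Bob wins. The game is canonical if $|L|=|V(G)|$. *)

theory Defs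
  imports Main
begin

section \<open>Graphs\<close>

text \<open>A simple graph is given by its vertex set and its set of two-element edges.\<close>

type_synonym 'v graph = "'v set \<times> 'v set set"

abbreviation verts :: "'v graph \<Rightarrow> 'v set" where "verts G \<equiv> fst G"
abbreviation edges :: "'v graph \<Rightarrow> 'v set set" where "edges G \<equiv> snd G"

definition simple_graph :: "'v graph \<Rightarrow> bool" where
  "simple_graph G \<longleftrightarrow>
     finite (verts G) \<and> (\<forall>e\<in>edges G. e \<subseteq> verts G \<and> card e = 2)"

definition complete_bipartite :: "nat \<Rightarrow> nat \<Rightarrow> (nat + nat) graph" where
  "complete_bipartite m n =
     (Inl ` {..<m} \<union> Inr ` {..<n}, {{Inl i, Inr j} | i j. i < m \<and> j < n})"

lemma simple_graph_complete_bipartite: "simple_graph (complete_bipartite m n)"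
  by (auto simp: simple_graph_def complete_bipartite_def)

lemma card_verts_complete_bipartite: "card (verts (complete_bipartite m n)) = m + n"
  by (subst complete_bipartite_def, simp, subst card_Un_disjoint) (auto simp: card_image)

section \<open>Edge-sum distinguishing labelings\<close>

text \<open>For an edge \<open>e = {u, v}\<close> with \<open>u \<noteq> v\<close> this is \<open>\<phi> u + \<phi> v\<close>.\<close>

definition edge_weight :: "('v \<Rightarrow> nat) \<Rightarrow> 'v set \<Rightarrow> nat" where
  "edge_weight \<phi> e = (\<Sum>v\<in>e. \<phi> v)"

definition ESD_labeling :: "'v graph \<Rightarrow> nat \<Rightarrow> ('v \<Rightarrow> nat) \<Rightarrow> bool" where
  "ESD_labeling G l \<phi> \<longleftrightarrow>
     \<phi> ` verts G \<subseteq> {1..l} \<and> inj_on \<phi> (verts G) \<and> inj_on (edge_weight \<phi>) (edges G)"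

section \<open>The labeling game\<close>

type_synonym 'v move = "'v \<times> nat"

text \<open>
  The position reached by a list of moves (in order of play) is the partial labeling it describes.
  No vertex is labeled twice in a play, so it does not matter that \<open>map_of\<close> prefers the
  first entry.
\<close>

abbreviation position :: "'v move list \<Rightarrow> ('v \<rightharpoonup> nat)" where
  "position h \<equiv> map_of h"

definition labeled_edges :: "'v graph \<Rightarrow> ('v \<rightharpoonup> nat) \<Rightarrow> 'v set set" where
  "labeled_edges G p = {e \<in> edges G. e \<subseteq> dom p}"

definition legal_move :: "'v graph \<Rightarrow> nat \<Rightarrow> ('v \<rightharpoonup> nat) \<Rightarrow> 'v move \<Rightarrow> bool" where
  "legal_move G l p = (\<lambda>(v, c).
     v \<in> verts G \<and> v \<notin> dom p \<and> c \<in> {1..l} \<and> c \<notin> ran p \<and>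
     inj_on (edge_weight (the \<circ> p(v \<mapsto> c))) (labeled_edges G (p(v \<mapsto> c))))"

definition ESD_created :: "'v graph \<Rightarrow> nat \<Rightarrow> ('v \<rightharpoonup> nat) \<Rightarrow> bool" where
  "ESD_created G l p \<longleftrightarrow> dom p = verts G \<and> ESD_labeling G l (the \<circ> p)"

definition game_over :: "'v graph \<Rightarrow> nat \<Rightarrow> ('v \<rightharpoonup> nat) \<Rightarrow> bool" where
  "game_over G l p \<longleftrightarrow> (\<nexists>m. legal_move G l p m) \<or> ESD_created G l p"

inductive play :: "'v graph \<Rightarrow> nat \<Rightarrow> 'v move list \<Rightarrow> bool" for G l where
  start: "play G l []"
| move: "play G l h \<Longrightarrow> \<not> game_over G l (position h) \<Longrightarrow> legal_move G l (position h) m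
          \<Longrightarrow> play G l (h @ [m])"

datatype player = Alice | Bob

definition to_move :: "'v move list \<Rightarrow> player" where
  "to_move h = (if even (length h) then Alice else Bob)"

definition winner :: "'v graph \<Rightarrow> nat \<Rightarrow> 'v move list \<Rightarrow> player" where
  "winner G l h = (if ESD_created G l (position h) then Alice else Bob)"

type_synonym 'v strategy = "'v move list \<Rightarrow> 'v move"

definition follows :: "player \<Rightarrow> 'v strategy \<Rightarrow> 'v move list \<Rightarrow> bool" where
  "follows P \<sigma> h \<longleftrightarrow> (\<forall>i<length h. to_move (take i h) = P \<longrightarrow> h ! i = \<sigma> (take i h))"

text \<open>
  A winning strategy must supply a legal move whenever its player has to move, and its player must
  win every finished play that follows it. On a finite graph every play ends, since each move
  labels a new vertex.
\<close>

definition winning_strategy :: "'v graph \<Rightarrow> nat \<Rightarrow> player \<Rightarrow> 'v strategy \<Rightarrow> bool" where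
  "winning_strategy G l P \<sigma> \<longleftrightarrow>
     (\<forall>h. play G l h \<and> follows P \<sigma> h \<longrightarrow>
        (if game_over G l (position h) then winner G l h = P
         else to_move h = P \<longrightarrow> legal_move G l (position h) (\<sigma> h)))"

definition has_winning_strategy :: "'v graph \<Rightarrow> nat \<Rightarrow> player \<Rightarrow> bool" where
  "has_winning_strategy G l P \<longleftrightarrow> (\<exists>\<sigma>. winning_strategy G l P \<sigma>)"

definition has_canonical_winning_strategy :: "'v graph \<Rightarrow> player \<Rightarrow> bool" where
  "has_canonical_winning_strategy G P \<longleftrightarrow> has_winning_strategy G (card (verts G)) P"

end

theory Submission
  imports Defs
begin

text \<open>
  In an ESD labeling of \<open>K\<^bsub>2,q\<^esub>\<close> with exactly \<open>n = q + 2\<close> labels, let \<open>a < b\<close> be the labels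
  of the two vertices on the small side. No two of the remaining labels differ by \<open>b - a\<close>;
  testing the pairs \<open>(a - 1, b - 1)\<close> and \<open>(a + 1, b + 1)\<close> and the pairs of consecutive
  labels leaves only \<open>{a, b} = {1, n}\<close>, and for \<open>n = 4\<close> also \<open>{a, b} = {2, 3}\<close>. Bob answers
  Alice's first move on the same side of the graph, where no edge is completed, with a label that
  rules out all of these pairs; afterwards he plays any legal move.
\<close>

lemma unavoidable_difference:
  fixes a b n :: nat
  assumes "1 \<le> a" "a < b" "b \<le> n" "4 \<le> n"
    and nodiff: "\<And>c. c \<in> {1..n} - {a, b} \<Longrightarrow> c + (b - a) \<notin> {1..n} - {a, b}"
  shows "(a = 1 \<and> b = n) \<or> (n = 4 \<and> a = 2 \<and> b = 3)"
proof (cases "b = a + 1")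
  case True
  have "a \<le> 2"
  proof (rule ccontr)
    assume "\<not> a \<le> 2"
    \<comment> \<open>With \<open>a = 3 + k\<close>, the label \<open>k + 1\<close> is
      \<open>a - 2\<close>, so the tested pair is \<open>a - 2\<close>,
      \<open>a - 1\<close>.\<close>
    then obtain k where "a = 3 + k"
      using le_Suc_ex[of 3 a] by auto
    then show False
      using nodiff[of "k + 1"] assms(3) True by auto
  qed
  moreover have "n \<le> a + 2"
  proof (rule ccontr)
    assume "\<not> n \<le> a + 2"
    then show False
      using nodiff[of "a + 2"] True by auto
  qed
  ultimately show ?thesis
    using assms(1-4) True by auto
next
  case False
  \<comment> \<open>Since \<open>b \<noteq> a + 1\<close>, the label \<open>b - 1\<close> differs
    from \<open>a\<close>, and below \<open>a + 1\<close> differs from \<open>b\<close>; so both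
    shifted pairs avoid \<open>a\<close> and \<open>b\<close>.\<close>
  have "a = 1"
  proof (rule ccontr)
    assume "a \<noteq> 1"
    then have "a - 1 \<in> {1..n} - {a, b}" "b - 1 \<in> {1..n} - {a, b}" "a - 1 + (b - a) = b - 1"
      using assms(1-3) False by auto
    then show False using nodiff by metis
  qed
  moreover have "b = n"
  proof (rule ccontr)
    assume "b \<noteq> n"
    then have "a + 1 \<in> {1..n} - {a, b}" "b + 1 \<in> {1..n} - {a, b}" "a + 1 + (b - a) = b + 1"
      using assms(1-3) False by auto
    then show False using nodiff by metis
  qed
  ultimately show ?thesis by simp
qed

lemma verts_complete_bipartite:
  "verts (complete_bipartite m n) = Inl ` {..<m} \<union> Inr ` {..<n}"
  by (simp add: complete_bipartite_def)

lemma edges_complete_bipartite: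
  "edges (complete_bipartite m n) = {{Inl i, Inr j} | i j. i < m \<and> j < n}"
  by (simp add: complete_bipartite_def)

text \<open>All labels other than the two small-side labels \<open>a < b\<close> sit on the big
  side. If \<open>c\<close> and \<open>c + (b - a)\<close> were both there, the edges with labels
  \<open>a\<close>, \<open>c + (b - a)\<close> and \<open>b\<close>, \<open>c\<close> would have
  equal weight.\<close>

lemma canonical_ESD_labeling_small_side:
  assumes "2 \<le> q" and esd: "ESD_labeling (complete_bipartite 2 q) (q + 2) \<phi>"
    and i: "i < 2" "i' < 2" and less: "\<phi> (Inl i) < \<phi> (Inl i')"
  shows "(\<phi> (Inl i) = 1 \<and> \<phi> (Inl i') = q + 2) \<or> (q = 2 \<and> \<phi> (Inl i) = 2 \<and> \<phi> (Inl i') = 3)"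
proof -
  let ?G = "complete_bipartite 2 q" and ?a = "\<phi> (Inl i)" and ?b = "\<phi> (Inl i')"
  have range: "\<phi> ` verts ?G \<subseteq> {1..q + 2}" and inj: "inj_on \<phi> (verts ?G)"
    and injw: "inj_on (edge_weight \<phi>) (edges ?G)"
    using esd by (auto simp: ESD_labeling_def)
  \<comment> \<open>There are as many labels as vertices, so injectivity forces every label to
    occur.\<close>
  have surj: "\<phi> ` verts ?G = {1..q + 2}"
    using range inj by (intro card_subset_eq) (auto simp: card_image card_verts_complete_bipartite)
  have "i \<noteq> i'" using less by auto
  then have sides: "{..<2} = {i, i'}" using i by auto
  have big_side: "\<exists>j<q. \<phi> (Inr j) = c" if "c \<in> {1..q + 2} - {?a, ?b}" for c
  proof -
    have "c \<in> \<phi> ` verts ?G" using that surj by auto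
    then show ?thesis using that by (auto simp: verts_complete_bipartite sides)
  qed
  have "c + (?b - ?a) \<notin> {1..q + 2} - {?a, ?b}" if c: "c \<in> {1..q + 2} - {?a, ?b}" for c
  proof
    assume "c + (?b - ?a) \<in> {1..q + 2} - {?a, ?b}"
    then obtain k where k: "k < q" "\<phi> (Inr k) = c + (?b - ?a)"
      using big_side by blast
    obtain j where j: "j < q" "\<phi> (Inr j) = c"
      using big_side c by blast
    have "edge_weight \<phi> {Inl i, Inr k} = edge_weight \<phi> {Inl i', Inr j}"
      using k j less by (simp add: edge_weight_def)
    moreover have "{Inl i, Inr k} \<in> edges ?G" "{Inl i', Inr j} \<in> edges ?G"
      using i j k unfolding edges_complete_bipartite by blast+
    ultimately have "{Inl i, Inr k} = {Inl i', Inr j :: nat + nat}"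
      using injw by (auto dest: inj_onD)
    then show False using \<open>i \<noteq> i'\<close> by (auto simp: doubleton_eq_iff)
  qed
  moreover have "?a \<in> {1..q + 2}" "?b \<in> {1..q + 2}"
    using i range by (auto simp: verts_complete_bipartite image_subset_iff simp del: atLeastAtMost_iff)
  ultimately show ?thesis
    using unavoidable_difference[of ?a ?b "q + 2"] less \<open>2 \<le> q\<close> by auto
qed

lemma play_distinct: "play G l h \<Longrightarrow> distinct (map fst h)"
  by (induction rule: play.induct) (force simp: legal_move_def dom_map_of_conv_image_fst)+

lemma play_legal_nth:
  "play G l h \<Longrightarrow> i < length h \<Longrightarrow> legal_move G l (position (take i h)) (h ! i)"
proof (induction rule: play.induct)
  case (move h m)
  then show ?case by (cases "i = length h") (auto simp: nth_append)
qed simp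

text \<open>Exactly one of \<open>x\<close> and the reply lies in \<open>{1, n}\<close>, and for
  \<open>n = 4\<close> also exactly one in \<open>{2, 3}\<close>. An admissible small-side pair is
  thus always split, so one reply serves on both sides of the graph.\<close>

definition reply_label :: "nat \<Rightarrow> nat \<Rightarrow> nat" where
  "reply_label n x = (if x = 1 \<or> x = n then 2 else 1)"

fun same_side :: "nat + nat \<Rightarrow> nat + nat" where
  "same_side (Inl i) = Inl (1 - i)"
| "same_side (Inr j) = Inr (if j = 0 then 1 else 0)"

definition reply :: "nat \<Rightarrow> (nat + nat) move \<Rightarrow> (nat + nat) move" where
  "reply n m = (same_side (fst m), reply_label n (snd m))"

text \<open>Length 1 marks Bob's first turn. By his later turns an ESD labeling is already excluded,
  so the choice only has to be legal; \<open>SOME\<close> provides this while the game is not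
  over.\<close>

definition bob :: "nat \<Rightarrow> (nat + nat) strategy" where
  "bob q h = (if length h = 1 then reply (q + 2) (h ! 0)
     else SOME m. legal_move (complete_bipartite 2 q) (q + 2) (position h) m)"

lemma same_side_in_verts:
  assumes "2 \<le> q" "v \<in> verts (complete_bipartite 2 q)"
  shows "same_side v \<in> verts (complete_bipartite 2 q)" "same_side v \<noteq> v"
  using assms by (auto simp: verts_complete_bipartite less_2_cases_iff split: if_splits)

lemma legal_reply:
  assumes "2 \<le> q" and m: "legal_move (complete_bipartite 2 q) (q + 2) Map.empty m"
  shows "legal_move (complete_bipartite 2 q) (q + 2) (position [m]) (reply (q + 2) m)"
proof -
  obtain v x where vx: "m = (v, x)" by fastforce
  then have v: "v \<in> verts (complete_bipartite 2 q)" and x: "x \<in> {1..q + 2}"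
    using m by (auto simp: legal_move_def)
  \<comment> \<open>Every edge joins the two sides, so no edge is fully labeled yet and only
    freshness of vertex and label remains to be checked.\<close>
  have "\<not> e \<subseteq> {same_side v, v}" if "e \<in> edges (complete_bipartite 2 q)" for e
    using that by (cases v) (auto simp: edges_complete_bipartite)
  then have "labeled_edges (complete_bipartite 2 q) [v \<mapsto> x, same_side v \<mapsto> y] = {}" for y
    by (auto simp: labeled_edges_def)
  then show ?thesis
    using same_side_in_verts[OF \<open>2 \<le> q\<close> v] x \<open>2 \<le> q\<close>
    by (auto simp: vx legal_move_def reply_def reply_label_def)
qed

lemma reply_label_mem:
  assumes "S = {1, q + 2} \<or> (q = 2 \<and> S = {2, 3})" "x \<in> {1..q + 2}" "x \<notin> S"
  shows "reply_label (q + 2) x \<in> S"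
  using assms by (auto simp: reply_label_def)

lemma reply_prevents_ESD:
  assumes "2 \<le> q" and esd: "ESD_labeling (complete_bipartite 2 q) (q + 2) \<phi>"
    and v: "v \<in> verts (complete_bipartite 2 q)"
  shows "\<phi> (same_side v) \<noteq> reply_label (q + 2) (\<phi> v)"
proof
  assume eq: "\<phi> (same_side v) = reply_label (q + 2) (\<phi> v)"
  have inj: "inj_on \<phi> (verts (complete_bipartite 2 q))"
    using esd by (simp add: ESD_labeling_def)
  have ne: "\<phi> (Inl 0) \<noteq> \<phi> (Inl 1)"
    using inj by (auto dest!: inj_onD simp: verts_complete_bipartite)
  have pair: "({\<phi> (Inl 0), \<phi> (Inl 1)} = {1, q + 2}) \<or> (q = 2 \<and> {\<phi> (Inl 0), \<phi> (Inl 1)} = {2, 3})"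
  proof (cases "\<phi> (Inl 0) < \<phi> (Inl 1)")
    case True
    then show ?thesis
      using canonical_ESD_labeling_small_side[OF assms(1,2), of 0 1] by auto
  next
    case False
    then show ?thesis
      using canonical_ESD_labeling_small_side[OF assms(1,2), of 1 0] ne by auto
  qed
  show False
  proof (cases v)
    case (Inl i)
    with v have "i = 0 \<or> i = 1" by (auto simp: verts_complete_bipartite)
    \<comment> \<open>Here the first two labels are the whole small-side pair, which
      \<open>reply_label\<close> never completes to an admissible one.\<close>
    then have "{\<phi> (Inl 0), \<phi> (Inl 1)} = {\<phi> v, reply_label (q + 2) (\<phi> v)}"
      using eq Inl by auto
    then show False
      using pair \<open>2 \<le> q\<close> by (auto simp: reply_label_def doubleton_eq_iff split: if_splits)
  next
    case (Inr j)
    \<comment> \<open>Here both labels are spent on the big side, so by injectivity neither is in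
      the small-side pair, although one of them has to be.\<close>
    have other: "\<phi> w \<noteq> \<phi> (Inl i)" if "i < 2" "w \<in> {v, same_side v}" for w i
    proof
      assume "\<phi> w = \<phi> (Inl i)"
      moreover have "w \<in> verts (complete_bipartite 2 q)"
        using that v same_side_in_verts[OF \<open>2 \<le> q\<close> v] by auto
      moreover have "Inl i \<in> verts (complete_bipartite 2 q)"
        using that by (simp add: verts_complete_bipartite)
      ultimately have "w = Inl i" using inj by (auto dest: inj_onD)
      then show False using that Inr by auto
    qed
    have "\<phi> v \<notin> {\<phi> (Inl 0), \<phi> (Inl 1)}" "reply_label (q + 2) (\<phi> v) \<notin> {\<phi> (Inl 0), \<phi> (Inl 1)}"
      using other[of 0] other[of 1] eq by force+
    moreover have "\<phi> v \<in> {1..q + 2}"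
      using esd v by (auto simp: ESD_labeling_def)
    ultimately show False
      using reply_label_mem[OF pair] by blast
  qed
qed

lemma bob_prevents_ESD:
  assumes "2 \<le> q" and play: "play (complete_bipartite 2 q) (q + 2) h" and "follows Bob (bob q) h"
  shows "\<not> ESD_created (complete_bipartite 2 q) (q + 2) (position h)"
proof
  assume esd: "ESD_created (complete_bipartite 2 q) (q + 2) (position h)"
  \<comment> \<open>A complete labeling takes at least \<open>q + 2\<close> moves, so Bob's first
    reply has been played.\<close>
  then have "card (dom (position h)) = 2 + q"
    by (simp add: ESD_created_def card_verts_complete_bipartite)
  moreover have "card (dom (position h)) \<le> length h"
    by (metis card_image_le dom_map_of_conv_image_fst card_length le_trans List.finite_set)
  ultimately have len: "1 < length h" by simp
  obtain v x where vx: "h ! 0 = (v, x)" by fastforce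
  have "legal_move (complete_bipartite 2 q) (q + 2) (position (take 0 h)) (h ! 0)"
    using play_legal_nth[OF play, of 0] len by (cases h) auto
  then have v: "v \<in> verts (complete_bipartite 2 q)"
    using vx by (auto simp: legal_move_def)
  have "h ! 1 = bob q (take 1 h)"
    using assms(3) len by (auto simp: follows_def to_move_def)
  also have "\<dots> = (same_side v, reply_label (q + 2) x)"
    using len vx by (simp add: bob_def reply_def)
  finally have "(same_side v, reply_label (q + 2) x) \<in> set h"
    using len by (metis nth_mem)
  moreover have "(v, x) \<in> set h"
    using len vx by (metis nth_mem less_trans zero_less_one)
  \<comment> \<open>As no vertex is labeled twice, the first two moves persist in the final
    labeling.\<close>
  ultimately have "position h v = Some x" "position h (same_side v) = Some (reply_label (q + 2) x)"
    using play_distinct[OF play] by simp_all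
  then show False
    using reply_prevents_ESD[OF \<open>2 \<le> q\<close> _ v, of "the \<circ> position h"] esd
    by (simp add: ESD_created_def)
qed

lemma legal_bob:
  assumes "2 \<le> q" and play: "play (complete_bipartite 2 q) (q + 2) h"
    and "\<not> game_over (complete_bipartite 2 q) (q + 2) (position h)"
  shows "legal_move (complete_bipartite 2 q) (q + 2) (position h) (bob q h)"
proof (cases "length h = 1")
  case True
  then obtain m where "h = [m]" by (auto simp: length_Suc_conv)
  then show ?thesis
    using legal_reply[OF \<open>2 \<le> q\<close>, of m] play_legal_nth[OF play, of 0] by (simp add: bob_def)
next
  case False
  then show ?thesis
    using assms(3) by (auto simp: bob_def game_over_def intro: someI)
qed

theorem theorem12:
  fixes q :: nat
  assumes "q \<ge> 2"
  shows "has_canonical_winning_strategy (complete_bipartite 2 q) Bob"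
proof -
  have "winning_strategy (complete_bipartite 2 q) (q + 2) Bob (bob q)"
    using bob_prevents_ESD[OF assms] legal_bob[OF assms]
    by (auto simp: winning_strategy_def winner_def)
  then show ?thesis
    by (auto simp: has_canonical_winning_strategy_def has_winning_strategy_def
        card_verts_complete_bipartite add.commute)
qed

end
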